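(* Let $p$ be a prime. If $\Psi\in\operatorname{Im}(\mathscr{I})$, then $\mathscr{S}^{-1}(\Psi)\in\operatorname{Im}(\mathscr{I})$. Specifically, $$\mathscr{S}^{-1}(\mathscr{I}(\psi)) = \mathscr{I}(-\Sigma\psi)$$ for all $\psi\in C(\mathbb{Z}_p,\mathbb{C}_p)$.
   Context: $C(\mathbb{Z}_p,\mathbb{C}_p)$ is the $\mathbb{C}_p$-vector space of continuous functions $\mathbb{Z}_p \to \mathbb{C}_p$, and $\mathscr{S}$ is the $\mathbb{C}_p$-linear automorphism of $C(\mathbb{Z}_p,\mathbb{C}_p)$ given by $\mathscr{S}(\phi)(x) = \phi(x) - x\phi(x-1)$. The map $\mathscr{I}$, defined on $C(\mathbb{Z}_p,\mathbb{C}_p)$, sends $\psi$ to the continuous function $\mathscr{I}(\psi):\mathbb{Z}_p\to\mathbb{C}_p$, $\mathscr{I}(\psi)(s) = \sum_{n=0}^\infty n!\,\psi(-1-n)\binom{s}{n}$, and $\operatorname{Im}(\mathscr{I})$ is its image. For $\psi\in C(\mathbb{Z}_p,\mathbb{C}_p)$, $\Sigma\psi:\mathbb{Z}_p\to\mathbb{C}_p$ is the indefinite sum of $\psi$, i.e. the unique continuous function with $(\Sigma\psi)(n) = \sum_{k=0}^{n-1}\psi(k)$ for all integers $n\ge0$. *)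

theory Defs
  imports "HOL-Analysis.Analysis" "HOL-Computational_Algebra.Computational_Algebra"
begin

definition padic_abs :: "nat \<Rightarrow> rat \<Rightarrow> real" where
  "padic_abs p r = (if r = 0 then 0 else
     (case quotient_of r of (a, b) \<Rightarrow>
        real p powi (int (multiplicity (int p) b) - int (multiplicity (int p) a))))"

text \<open>
  The completions \<open>\<rat>\<^sub>p\<close> of \<open>\<rat>\<close> and \<open>\<int>\<^sub>p\<close> of \<open>\<int>\<close> are taken inside an ambient complete field, hence
  appear as closures. They carry their p-adic meaning when the topology of \<open>'c\<close> is the one
  prescribed by the locale \<open>padic_complex_numbers\<close> below.
\<close>

definition Qp :: "'c::{field_char_0, topological_space} set" where
  "Qp = closure \<rat>"

definition Zp :: "'c::{field_char_0, topological_space} set" where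
  "Zp = closure \<int>"

definition Qp_bar :: "'c::{field_char_0, topological_space} set" where
  "Qp_bar = {x. \<exists>f. f \<noteq> 0 \<and> (\<forall>i. coeff f i \<in> Qp) \<and> poly f x = 0}"

text \<open>
  The locale says that the type \<open>'c\<close>, with absolute value \<open>av\<close>, is \<open>\<complex>\<^sub>p\<close>: the completion of an
  algebraic closure of \<open>\<rat>\<^sub>p\<close>, under the absolute value extending the p-adic one. Completeness of
  \<open>'c\<close> is the class constraint \<open>complete_space\<close>. Consequently \<open>Qp\<close> is the completion of \<open>\<rat>\<close> by
  \<open>av_of_rat\<close>, \<open>Qp_bar\<close> (algebraic over \<open>Qp\<close> by definition) is an algebraic closure of \<open>Qp\<close> by
  \<open>Qp_bar_alg_closed\<close>, and \<open>'c\<close> is the completion of \<open>Qp_bar\<close> by \<open>Qp_bar_dense\<close>. These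
  conditions determine \<open>'c\<close> up to isometric isomorphism of fields.
\<close>

locale padic_complex_numbers =
  fixes p :: nat
    and av :: "'c::{field_char_0, complete_space} \<Rightarrow> real"
  assumes prime_p: "prime p"
    and dist_av: "dist x y = av (x - y)"
    and av_mult: "av (x * y) = av x * av y"
    and av_add: "av (x + y) \<le> max (av x) (av y)"
    and av_of_rat: "av (of_rat r) = padic_abs p r"
    and Qp_bar_alg_closed:
      "(\<And>i. coeff f i \<in> (Qp_bar :: 'c set)) \<Longrightarrow> degree f > 0 \<Longrightarrow> \<exists>x\<in>Qp_bar. poly f x = 0"
    and Qp_bar_dense: "closure (Qp_bar :: 'c set) = UNIV"

text \<open>
  A function \<open>\<int>\<^sub>p \<rightarrow> \<complex>\<^sub>p\<close> is represented by the function on \<open>'c\<close> that is \<open>undefined\<close> off \<open>Zp\<close>, so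
  that HOL equality is equality of functions on \<open>\<int>\<^sub>p\<close>.
\<close>

definition C_Zp :: "('c::{field_char_0, topological_space} \<Rightarrow> 'c) set" where
  "C_Zp = {\<phi> \<in> extensional Zp. continuous_on Zp \<phi>}"

definition script_S ::
    "('c::{field_char_0, topological_space} \<Rightarrow> 'c) \<Rightarrow> 'c \<Rightarrow> 'c" where
  "script_S \<phi> = (\<lambda>x\<in>Zp. \<phi> x - x * \<phi> (x - 1))"

definition script_I ::
    "('c::{field_char_0, topological_space} \<Rightarrow> 'c) \<Rightarrow> 'c \<Rightarrow> 'c" where
  "script_I \<psi> = (\<lambda>s\<in>Zp. \<Sum>n. fact n * \<psi> (- 1 - of_nat n) * (s gchoose n))"

definition indef_sum ::
    "('c::{field_char_0, topological_space} \<Rightarrow> 'c) \<Rightarrow> 'c \<Rightarrow> 'c" where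
  "indef_sum \<psi> = (THE F. F \<in> C_Zp \<and> (\<forall>n::nat. F (of_nat n) = (\<Sum>k<n. \<psi> (of_nat k))))"

text \<open>
  \<open>script_S\<close> is a bijection of \<open>C_Zp\<close> onto itself (under \<open>padic_complex_numbers\<close>), so this is its
  two-sided inverse there.
\<close>

definition script_S_inv ::
    "('c::{field_char_0, topological_space} \<Rightarrow> 'c) \<Rightarrow> 'c \<Rightarrow> 'c" where
  "script_S_inv = inv_into C_Zp script_S"

end

theory Submission
  imports Defs
begin

text \<open>
  Since \<open>n! * (s gchoose n)\<close> is the falling factorial \<open>s (s - 1) \<dots> (s - n + 1)\<close>, the function
  \<open>script_I \<phi>\<close> is a series in falling factorials with coefficients \<open>\<phi> (- 1 - n)\<close>. Multiplying the
  \<open>n\<close>-th falling factorial at \<open>x - 1\<close> by \<open>x\<close> gives the \<open>(n + 1)\<close>-st at \<open>x\<close>, so \<open>script_S\<close> merely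
  replaces the coefficients by their differences \<open>\<phi> (- 1 - n) - \<phi> (- n)\<close>, up to a boundary term
  \<open>\<phi> 0\<close>. For \<open>\<phi> = - indef_sum \<psi>\<close> the boundary term is zero and the difference at \<open>n\<close> is
  \<open>\<psi> (- 1 - n)\<close>, because \<open>indef_sum \<psi> (x + 1) - indef_sum \<psi> x = \<psi> x\<close> extends by density from the
  natural numbers to \<open>Zp\<close>. Hence \<open>script_S (script_I (- indef_sum \<psi>)) = script_I \<psi>\<close>
  (\<open>script_S_script_I\<close>). As \<open>script_S\<close> is injective on continuous functions
  (\<open>inj_on_script_S\<close>), its inverse takes \<open>script_I \<psi>\<close> to \<open>script_I (- indef_sum \<psi>)\<close>.

  Two analytic facts make this meaningful. The falling factorials tend to zero uniformly on \<open>Zp\<close>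
  (\<open>av_falling_le\<close>) and continuous functions on the compact space \<open>Zp\<close> are bounded, so the series
  converge uniformly to continuous functions. And the partial sums of a continuous \<open>\<psi>\<close> are p-adically
  uniformly continuous (\<open>partial_sums_uniformly_continuous\<close>), so that they extend from the natural
  numbers to \<open>Zp\<close> and \<open>indef_sum \<psi>\<close> really is the function that its definition describes.
\<close>

section \<open>Falling factorials\<close>

definition falling :: "'a::comm_ring_1 \<Rightarrow> nat \<Rightarrow> 'a" where
  "falling s n = (\<Prod>i<n. s - of_nat i)"

lemma falling_0 [simp]: "falling s 0 = 1"
  by (simp add: falling_def)

lemma falling_Suc: "falling s (Suc n) = falling s n * (s - of_nat n)"
  by (simp add: falling_def)

lemma falling_shift: "s * falling (s - 1) n = falling s (Suc n)"
proof (induction n)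
  case (Suc n)
  have "s * falling (s - 1) (Suc n) = (s * falling (s - 1) n) * (s - 1 - of_nat n)"
    by (simp add: falling_Suc)
  then show ?case
    unfolding Suc by (simp add: falling_Suc algebra_simps)
qed (simp add: falling_Suc)

lemma falling_add: "falling s (n + m) = falling s n * falling (s - of_nat n) m"
  for s :: "'a::comm_ring_1"
  by (induction m) (simp_all add: falling_Suc algebra_simps)

lemma script_I_falling:
  "script_I \<psi> = (\<lambda>s\<in>Zp. \<Sum>n. \<psi> (- 1 - of_nat n) * falling s n)"
proof -
  have "fact n * (s gchoose n) = falling s n" for s :: 'a and n
    by (simp add: gbinomial_mult_fact falling_def atLeast0LessThan)
  then have "fact n * \<psi> (- 1 - of_nat n) * (s gchoose n) = \<psi> (- 1 - of_nat n) * falling s n"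
    for s n
    by (metis mult.assoc mult.commute)
  then show ?thesis
    unfolding script_I_def by presburger
qed

lemma sum_split_at:
  fixes f :: "nat \<Rightarrow> 'a::comm_monoid_add"
  shows "(\<Sum>k<n + m. f k) = (\<Sum>k<n. f k) + (\<Sum>k<m. f (n + k))"
  by (induction m) (simp_all add: add.assoc)

section \<open>Ultrametric estimates\<close>

context padic_complex_numbers
begin

lemma p_gt_1: "real p > 1"
  using prime_gt_1_nat[OF prime_p] by simp

lemma av_0 [simp]: "av 0 = 0"
  using dist_av[of 0 0] by simp

lemma av_nonneg [simp]: "0 \<le> av x"
  using dist_av[of x 0] by (metis diff_zero zero_le_dist)

lemma av_eq_0_iff [simp]: "av x = 0 \<longleftrightarrow> x = 0"
  using dist_av[of x 0] by (metis diff_zero dist_eq_0_iff)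

lemma av_1 [simp]: "av 1 = 1"
  using av_mult[of 1 1] av_eq_0_iff[of 1] by simp

lemma av_uminus [simp]: "av (- x) = av x"
  using dist_av[of 0 x] dist_av[of x 0] by (simp add: dist_commute)

lemma av_diff_commute: "av (x - y) = av (y - x)"
  using av_uminus[of "x - y"] by simp

lemma av_add_le: "av x \<le> e \<Longrightarrow> av y \<le> e \<Longrightarrow> av (x + y) \<le> e"
  using av_add[of x y] by linarith

lemma av_sum_le:
  assumes "\<And>k. k \<in> A \<Longrightarrow> av (f k) \<le> e" and "0 \<le> e"
  shows "av (\<Sum>k\<in>A. f k) \<le> e"
  using assms by (induction A rule: infinite_finite_induct) (auto intro: av_add_le)

text \<open>
  The prescribed values of \<open>av\<close> on rational numbers enter the proof through integers only, as a
  dictionary between p-adic closeness and congruence modulo powers of \<open>p\<close>.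
\<close>

lemma av_of_int:
  assumes "z \<noteq> 0"
  shows "av (of_int z) = (1 / real p) ^ multiplicity (int p) z"
proof -
  have "av (of_int z) = padic_abs p (of_int z)"
    using av_of_rat[of "of_int z"] by simp
  also have "\<dots> = real p powi (- int (multiplicity (int p) z))"
    using assms by (simp add: padic_abs_def)
  finally show ?thesis
    by (simp add: power_int_minus power_one_over inverse_eq_divide)
qed

lemma av_of_int_le_iff:
  "av (of_int z) \<le> (1 / real p) ^ k \<longleftrightarrow> int p ^ k dvd z"
proof (cases "z = 0")
  case False
  have nu: "\<not> is_unit (int p)"
    using prime_p not_prime_unit by auto
  have "av (of_int z) \<le> (1 / real p) ^ k \<longleftrightarrow> k \<le> multiplicity (int p) z"
    unfolding av_of_int[OF False] using p_gt_1 by (intro power_decreasing_iff) auto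
  then show ?thesis
    using power_dvd_iff_le_multiplicity[of z "int p" k] False nu by simp
qed simp

lemma av_p_power: "av (of_nat (p ^ k)) \<le> (1 / real p) ^ k"
  using av_of_int_le_iff[of "int (p ^ k)" k] by simp

lemma p_power_tendsto_0: "(\<lambda>k. (1 / real p) ^ k) \<longlonglongrightarrow> 0"
  using p_gt_1 by (intro LIMSEQ_power_zero) simp

lemma p_power_small:
  assumes "0 < e"
  obtains k where "(1 / real p) ^ k < e"
  using real_arch_pow_inv[OF assms, of "1 / real p"] p_gt_1 by auto

section \<open>Limits of sums and products\<close>

text \<open>
  The type \<open>'c\<close> is only a field with a complete metric; that its field operations are continuous
  follows from the metric being given by \<open>av\<close>.
\<close>

lemma tendsto_av_iff:
  fixes f :: "'a \<Rightarrow> 'c"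
  shows "(f \<longlongrightarrow> a) F \<longleftrightarrow> ((\<lambda>x. av (f x - a)) \<longlongrightarrow> 0) F"
  using tendsto_dist_iff[of f a F] by (simp add: dist_av)

lemma tendsto_diff_av:
  fixes f g :: "'a \<Rightarrow> 'c"
  assumes "(f \<longlongrightarrow> a) F" "(g \<longlongrightarrow> b) F"
  shows "((\<lambda>x. f x - g x) \<longlongrightarrow> a - b) F"
  unfolding tendsto_av_iff
proof (rule tendsto_sandwich[where f = "\<lambda>_. 0"])
  show "((\<lambda>x. max (av (f x - a)) (av (g x - b))) \<longlongrightarrow> 0) F"
    using tendsto_max[of _ 0 F _ 0] assms unfolding tendsto_av_iff by simp
  have "av (f x - g x - (a - b)) \<le> max (av (f x - a)) (av (g x - b))" for x
    using av_add[of "f x - a" "- (g x - b)"] by (simp add: algebra_simps av_diff_commute)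
  then show "\<forall>\<^sub>F x in F. av (f x - g x - (a - b)) \<le> max (av (f x - a)) (av (g x - b))"
    by simp
qed simp_all

lemma tendsto_uminus_av:
  fixes f :: "'a \<Rightarrow> 'c"
  shows "(f \<longlongrightarrow> a) F \<Longrightarrow> ((\<lambda>x. - f x) \<longlongrightarrow> - a) F"
  using tendsto_diff_av[of "\<lambda>_. 0" 0 F f a] by simp

lemma tendsto_add_av:
  fixes f g :: "'a \<Rightarrow> 'c"
  shows "(f \<longlongrightarrow> a) F \<Longrightarrow> (g \<longlongrightarrow> b) F \<Longrightarrow> ((\<lambda>x. f x + g x) \<longlongrightarrow> a + b) F"
  using tendsto_diff_av[of f a F "\<lambda>x. - g x" "- b"] tendsto_uminus_av[of g b F] by simp

lemma tendsto_mult_av: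
  fixes f g :: "'a \<Rightarrow> 'c"
  assumes "(f \<longlongrightarrow> a) F" "(g \<longlongrightarrow> b) F"
  shows "((\<lambda>x. f x * g x) \<longlongrightarrow> a * b) F"
  unfolding tendsto_av_iff
proof (rule tendsto_sandwich[where f = "\<lambda>_. 0"])
  let ?h = "\<lambda>x. av (f x - a) * av (g x - b) + av a * av (g x - b) + av (f x - a) * av b"
  have "(?h \<longlongrightarrow> 0 * 0 + av a * 0 + 0 * av b) F"
    using assms unfolding tendsto_av_iff by (intro tendsto_intros)
  then show "(?h \<longlongrightarrow> 0) F"
    by simp
  have "av (f x * g x - a * b) \<le> ?h x" for x
  proof -
    have "f x * g x - a * b = (f x - a) * (g x - b) + a * (g x - b) + (f x - a) * b"
      by (simp add: algebra_simps)
    also have "av \<dots> \<le> ?h x"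
      by (intro av_add_le) (simp_all add: av_mult)
    finally show ?thesis .
  qed
  then show "\<forall>\<^sub>F x in F. av (f x * g x - a * b) \<le> ?h x"
    by simp
qed simp_all

lemma continuous_on_sum_av:
  fixes f :: "nat \<Rightarrow> 'c \<Rightarrow> 'c"
  shows "(\<And>k. continuous_on A (f k)) \<Longrightarrow> continuous_on A (\<lambda>x. \<Sum>k<(n::nat). f k x)"
  unfolding continuous_on_def by (induction n) (auto intro: tendsto_add_av)

lemma continuous_on_falling: "continuous_on A (\<lambda>s::'c. falling s n)"
  unfolding continuous_on_def
  by (induction n) (auto simp: falling_Suc intro!: tendsto_mult_av tendsto_diff_av)

text \<open>
  In a complete ultrametric field, terms tending to zero uniformly are enough for uniform
  convergence of the series: a tail sum is no larger than its largest term.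
\<close>

lemma uniform_limit_suminf_av:
  fixes f :: "nat \<Rightarrow> 'c \<Rightarrow> 'c"
  assumes bound: "\<And>n x. x \<in> A \<Longrightarrow> av (f n x) \<le> c n" and c: "c \<longlonglongrightarrow> 0"
  shows "uniform_limit A (\<lambda>n x. \<Sum>k<n. f k x) (\<lambda>x. \<Sum>k. f k x) sequentially"
proof -
  have "uniformly_Cauchy_on A (\<lambda>n x. \<Sum>k<n. f k x)"
  proof (rule uniformly_Cauchy_onI')
    fix e :: real assume e: "e > 0"
    then obtain M where M: "\<And>n. n \<ge> M \<Longrightarrow> c n < e / 2"
      using order_tendstoD(2)[OF c, of "e / 2"] unfolding eventually_sequentially by auto
    have "dist (\<Sum>k<m. f k x) (\<Sum>k<n. f k x) < e" if "x \<in> A" "m \<ge> M" "n > m" for x m n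
    proof -
      have "(\<Sum>k<n. f k x) - (\<Sum>k<m. f k x) = (\<Sum>k<n - m. f (m + k) x)"
        using sum_split_at[of "\<lambda>k. f k x" m "n - m"] that by simp
      also have "av \<dots> \<le> e / 2"
      proof (rule av_sum_le)
        fix k
        show "av (f (m + k) x) \<le> e / 2"
          using bound[OF \<open>x \<in> A\<close>, of "m + k"] M[of "m + k"] that by linarith
      qed (use e in simp)
      finally show ?thesis
        using e by (simp add: dist_av av_diff_commute)
    qed
    then show "\<exists>M. \<forall>x\<in>A. \<forall>m\<ge>M. \<forall>n>m. dist (\<Sum>k<m. f k x) (\<Sum>k<n. f k x) < e"
      by blast
  qed
  then obtain g where g: "uniform_limit A (\<lambda>n x. \<Sum>k<n. f k x) g sequentially"
    using Cauchy_uniformly_convergent uniformly_convergent_on_def by blast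
  have "(\<Sum>k. f k x) = g x" if "x \<in> A" for x
    using sums_unique[of "\<lambda>k. f k x" "g x"] tendsto_uniform_limitI[OF g that]
    by (simp add: sums_def)
  then show ?thesis
    using g by (subst uniform_limit_cong'[where g = "\<lambda>n x. \<Sum>k<n. f k x" and i = g]) auto
qed

section \<open>The p-adic integers\<close>

lemma of_int_in_Zp [simp]: "of_int z \<in> (Zp :: 'c set)"
  unfolding Zp_def using closure_subset[of "\<int> :: 'c set"] by auto

lemma of_nat_in_Zp [simp]: "of_nat n \<in> (Zp :: 'c set)"
  using of_int_in_Zp[of "int n"] by simp

lemma Zp_diff:
  assumes "x \<in> (Zp :: 'c set)" "y \<in> Zp"
  shows "x - y \<in> Zp"
proof -
  obtain f g where f: "\<And>n. f n \<in> \<int>" "f \<longlonglongrightarrow> x" and g: "\<And>n. g n \<in> \<int>" "g \<longlonglongrightarrow> y"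
    using assms unfolding Zp_def closure_sequential by blast
  have "(\<lambda>n. f n - g n) \<longlonglongrightarrow> x - y"
    by (rule tendsto_diff_av[OF f(2) g(2)])
  moreover have "f n - g n \<in> \<int>" for n
    using f(1) g(1) by simp
  ultimately show ?thesis
    unfolding Zp_def closure_sequential by (intro exI[of _ "\<lambda>n. f n - g n"]) simp
qed

lemma Zp_add: "x \<in> (Zp :: 'c set) \<Longrightarrow> y \<in> Zp \<Longrightarrow> x + y \<in> Zp"
  using Zp_diff[of x "0 - y"] Zp_diff[of 0 y] of_nat_in_Zp[of 0] by simp

lemma Zp_minus_of_nat [simp]:
  "- 1 - of_nat n \<in> (Zp :: 'c set)" "- of_nat n \<in> (Zp :: 'c set)"
  using of_int_in_Zp[of "- 1 - int n"] of_int_in_Zp[of "- int n"] by simp_all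

text \<open>
  Reducing an integer approximation modulo \<open>p ^ k\<close> shows that \<open>Zp\<close> is covered by the finitely many
  residue classes modulo \<open>p ^ k\<close>. Density of the natural numbers, total boundedness, and the
  decay of falling factorials all come from this.
\<close>

lemma Zp_residue:
  assumes "x \<in> (Zp :: 'c set)"
  obtains r where "r < p ^ k" "av (x - of_nat r) \<le> (1 / real p) ^ k"
proof -
  have pos: "0 < (1 / real p) ^ k"
    using p_gt_1 by simp
  obtain z where z: "dist (of_int z) x < (1 / real p) ^ k"
    using assms pos unfolding Zp_def closure_approachable Ints_def by blast
  define r where "r = nat (z mod int p ^ k)"
  have pk: "int p ^ k > 0"
    using prime_gt_0_nat[OF prime_p] by simp
  have r: "int r = z mod int p ^ k"
    using pk by (simp add: r_def)
  have "int r < int (p ^ k)"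
    using pos_mod_bound[OF pk, of z] unfolding r by simp
  then have "r < p ^ k"
    by (simp only: of_nat_less_iff)
  have "av (of_int (z - int r)) \<le> (1 / real p) ^ k"
    unfolding av_of_int_le_iff r by (simp add: minus_mod_eq_mult_div)
  moreover have "av (x - of_int z) \<le> (1 / real p) ^ k"
    using z by (simp add: dist_av av_diff_commute)
  ultimately have "av ((x - of_int z) + of_int (z - int r)) \<le> (1 / real p) ^ k"
    by (intro av_add_le)
  with \<open>r < p ^ k\<close> show thesis
    by (intro that[of r]) simp_all
qed

lemma av_Zp_le_1: "x \<in> (Zp :: 'c set) \<Longrightarrow> av x \<le> 1"
  using Zp_residue[of x 0] by auto

lemma Zp_eq_closure_of_nat: "(Zp :: 'c set) = closure (range of_nat)"
proof
  show "(Zp :: 'c set) \<subseteq> closure (range of_nat)"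
  proof
    fix x :: 'c assume x: "x \<in> Zp"
    show "x \<in> closure (range of_nat)"
      unfolding closure_approachable
    proof (intro allI impI)
      fix e :: real assume "0 < e"
      then obtain k where k: "(1 / real p) ^ k < e"
        by (rule p_power_small)
      obtain r where "av (x - of_nat r) \<le> (1 / real p) ^ k"
        by (rule Zp_residue[OF x])
      with k show "\<exists>y\<in>range of_nat. dist y x < e"
        by (intro bexI[of _ "of_nat r"]) (auto simp: dist_av av_diff_commute[of _ x])
    qed
  qed
  show "closure (range of_nat) \<subseteq> (Zp :: 'c set)"
    unfolding Zp_def by (intro closure_mono) auto
qed

lemma Zp_eqI:
  fixes f g :: "'c \<Rightarrow> 'c"
  assumes f: "continuous_on Zp f" and g: "continuous_on Zp g"
    and eq: "\<And>n. f (of_nat n) = g (of_nat n)" and x: "x \<in> Zp"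
  shows "f x = g x"
proof -
  obtain u where u: "\<And>n. u n \<in> range of_nat" "u \<longlonglongrightarrow> x"
    using x unfolding Zp_eq_closure_of_nat closure_sequential by blast
  have uZ: "u n \<in> Zp" for n
    using u(1)[of n] by auto
  have "(\<lambda>n. f (u n)) \<longlonglongrightarrow> f x" "(\<lambda>n. g (u n)) \<longlonglongrightarrow> g x"
    using continuous_on_tendsto_compose[OF f u(2) x] continuous_on_tendsto_compose[OF g u(2) x] uZ
    by auto
  moreover have "f (u n) = g (u n)" for n
    using u(1)[of n] eq by auto
  ultimately show ?thesis
    using LIMSEQ_unique by auto
qed

lemma C_Zp_eqI:
  assumes "f \<in> C_Zp" "g \<in> C_Zp" "\<And>n. f (of_nat n) = g (of_nat n :: 'c)"
  shows "f = g"
proof (rule extensionalityI)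
  show "f x = g x" if "x \<in> Zp" for x
    using assms(1,2) that unfolding C_Zp_def by (intro Zp_eqI[of f g, OF _ _ assms(3)]) simp_all
qed (use assms in \<open>simp_all add: C_Zp_def\<close>)

lemma compact_Zp: "compact (Zp :: 'c set)"
  unfolding compact_eq_totally_bounded
proof (intro conjI allI impI)
  show "complete (Zp :: 'c set)"
    unfolding complete_eq_closed by (simp add: Zp_def)
  fix e :: real assume "0 < e"
  then obtain k where k: "(1 / real p) ^ k < e"
    by (rule p_power_small)
  have "(Zp :: 'c set) \<subseteq> (\<Union>x\<in>of_nat ` {..<p ^ k}. ball x e)"
  proof
    fix x :: 'c assume "x \<in> Zp"
    then obtain r where "r < p ^ k" "av (x - of_nat r) \<le> (1 / real p) ^ k"
      by (rule Zp_residue)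
    then show "x \<in> (\<Union>x\<in>of_nat ` {..<p ^ k}. ball x e)"
      using k by (auto simp: dist_av av_diff_commute[of _ x] intro!: bexI[of _ r])
  qed
  then show "\<exists>A. finite A \<and> (Zp :: 'c set) \<subseteq> (\<Union>x\<in>A. ball x e)"
    by (intro exI[of _ "of_nat ` {..<p ^ k}"]) simp
qed

lemma C_Zp_bounded:
  assumes "\<psi> \<in> (C_Zp :: ('c \<Rightarrow> 'c) set)"
  obtains B where "0 < B" "\<And>x. x \<in> Zp \<Longrightarrow> av (\<psi> x) \<le> B"
proof -
  have "bounded (\<psi> ` Zp)"
    using assms compact_continuous_image[OF _ compact_Zp] unfolding C_Zp_def
    by (auto intro: compact_imp_bounded)
  then obtain B where B: "\<And>x. x \<in> Zp \<Longrightarrow> dist 0 (\<psi> x) \<le> B"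
    unfolding bounded_any_center[where a = 0] by blast
  show thesis
  proof (rule that[of "max B 1"])
    fix x :: 'c assume "x \<in> Zp"
    then show "av (\<psi> x) \<le> max B 1"
      using B[of x] by (simp add: dist_av)
  qed simp
qed

section \<open>Existence of the indefinite sum\<close>

text \<open>
  Let \<open>\<psi>\<close> vary by less than \<open>e\<close> on residue classes modulo \<open>p ^ M\<close>. Up to an error of size \<open>e\<close>, a
  block of \<open>p ^ (M + j)\<close> consecutive values then consists of \<open>p ^ j\<close> copies of one block of
  \<open>p ^ M\<close> values, and the multiplicity \<open>p ^ j\<close> is itself p-adically small. Errors do not
  accumulate because the absolute value is ultrametric.
\<close>

lemma block_sum_small:
  fixes \<psi> :: "'c \<Rightarrow> 'c"
  assumes "\<psi> \<in> C_Zp" "0 < e"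
  obtains N where "\<And>n. av (\<Sum>k<p ^ N. \<psi> (of_nat (n + k))) \<le> e"
proof -
  have "uniformly_continuous_on Zp \<psi>"
    using assms(1) compact_Zp unfolding C_Zp_def by (auto intro: compact_uniformly_continuous)
  then obtain d where "0 < d"
    and d: "\<And>x y. x \<in> Zp \<Longrightarrow> y \<in> Zp \<Longrightarrow> dist y x < d \<Longrightarrow> dist (\<psi> y) (\<psi> x) < e"
    using assms(2) unfolding uniformly_continuous_on_def by metis
  obtain M where M: "(1 / real p) ^ M < d"
    using \<open>0 < d\<close> by (rule p_power_small)
  obtain B where B: "0 < B" "\<And>x. x \<in> Zp \<Longrightarrow> av (\<psi> x) \<le> B"
    using C_Zp_bounded[OF assms(1)] by blast
  obtain j where j: "(1 / real p) ^ j < e / B"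
    using p_power_small[of "e / B"] assms(2) B(1) by auto
  have shift: "av (\<psi> (of_nat (n + p ^ M * t)) - \<psi> (of_nat n)) \<le> e" for n t
  proof -
    have "av (of_int (int (p ^ M * t))) \<le> (1 / real p) ^ M"
      unfolding av_of_int_le_iff by simp
    then have "dist (of_nat (n + p ^ M * t)) (of_nat n :: 'c) < d"
      using M by (simp add: dist_av)
    then have "dist (\<psi> (of_nat (n + p ^ M * t))) (\<psi> (of_nat n)) < e"
      by (intro d of_nat_in_Zp)
    then show ?thesis
      by (simp only: dist_av less_imp_le)
  qed
  have blocks: "av ((\<Sum>k<p ^ M * t. \<psi> (of_nat (n + k)))
      - of_nat t * (\<Sum>k<p ^ M. \<psi> (of_nat (n + k)))) \<le> e" for n t
  proof (induction t)
    case (Suc t)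
    have "(\<Sum>k<p ^ M * Suc t. \<psi> (of_nat (n + k)))
        - of_nat (Suc t) * (\<Sum>k<p ^ M. \<psi> (of_nat (n + k)))
      = ((\<Sum>k<p ^ M * t. \<psi> (of_nat (n + k))) - of_nat t * (\<Sum>k<p ^ M. \<psi> (of_nat (n + k))))
        + (\<Sum>k<p ^ M. \<psi> (of_nat (n + k + p ^ M * t)) - \<psi> (of_nat (n + k)))"
      using sum_split_at[of "\<lambda>k. \<psi> (of_nat (n + k))" "p ^ M * t" "p ^ M"]
      by (simp add: sum_subtractf algebra_simps)
    also have "av \<dots> \<le> e"
      by (intro av_add_le av_sum_le Suc shift less_imp_le[OF assms(2)])
    finally show ?case .
  qed (use assms(2) in simp)
  have "av (\<Sum>k<p ^ (M + j). \<psi> (of_nat (n + k))) \<le> e" for n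
  proof -
    let ?s = "\<Sum>k<p ^ M. \<psi> (of_nat (n + k))"
    have "av ?s \<le> B"
      by (intro av_sum_le B(2) of_nat_in_Zp less_imp_le[OF B(1)])
    then have "av (of_nat (p ^ j) * ?s) \<le> (1 / real p) ^ j * B"
      unfolding av_mult using av_p_power[of j] by (intro mult_mono) auto
    also have "\<dots> \<le> e"
      using j B(1) by (simp add: field_simps)
    finally have "av (((\<Sum>k<p ^ M * p ^ j. \<psi> (of_nat (n + k))) - of_nat (p ^ j) * ?s)
        + of_nat (p ^ j) * ?s) \<le> e"
      using blocks[of n "p ^ j"] by (intro av_add_le)
    then show ?thesis
      by (simp add: power_add)
  qed
  then show thesis
    by (rule that)
qed

text \<open>
  P-adically close indices differ by a multiple of \<open>p ^ N\<close>, so their partial sums differ by a sum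
  of whole blocks, each of size at most \<open>e\<close>.
\<close>

lemma partial_sums_uniformly_continuous:
  fixes \<psi> :: "'c \<Rightarrow> 'c"
  assumes "\<psi> \<in> C_Zp" "0 < e"
  obtains d where "0 < d"
    "\<And>m n. av (of_nat m - of_nat n) < d \<Longrightarrow>
      av ((\<Sum>k<m. \<psi> (of_nat k)) - (\<Sum>k<n. \<psi> (of_nat k))) \<le> e"
proof -
  obtain N where N: "\<And>n. av (\<Sum>k<p ^ N. \<psi> (of_nat (n + k))) \<le> e"
    using block_sum_small[OF assms] by blast
  have mult: "av (\<Sum>k<p ^ N * t. \<psi> (of_nat (n + k))) \<le> e" for n t
  proof (induction t)
    case (Suc t)
    have "(\<Sum>k<p ^ N * Suc t. \<psi> (of_nat (n + k)))
      = (\<Sum>k<p ^ N * t. \<psi> (of_nat (n + k))) + (\<Sum>k<p ^ N. \<psi> (of_nat ((n + p ^ N * t) + k)))"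
      using sum_split_at[of "\<lambda>k. \<psi> (of_nat (n + k))" "p ^ N * t" "p ^ N"]
      by (simp add: algebra_simps)
    then show ?case
      using Suc N[of "n + p ^ N * t"] by (simp only: av_add_le)
  qed (use assms(2) in simp)
  have le: "av ((\<Sum>k<m. \<psi> (of_nat k)) - (\<Sum>k<n. \<psi> (of_nat k))) \<le> e"
    if "n \<le> m" "av (of_nat m - of_nat n) < (1 / real p) ^ N" for m n
  proof -
    have "av (of_int (int (m - n))) \<le> (1 / real p) ^ N"
      using that by (simp add: of_nat_diff)
    then have "int (p ^ N) dvd int (m - n)"
      unfolding av_of_int_le_iff by simp
    then obtain t where t: "m - n = p ^ N * t"
      unfolding int_dvd_int_iff by (rule dvdE)
    then have "m = n + p ^ N * t"
      using that(1) by simp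
    then show ?thesis
      using sum_split_at[of "\<lambda>k. \<psi> (of_nat k)" n "p ^ N * t"] mult[where n = n and t = t] by simp
  qed
  show thesis
  proof (rule that[of "(1 / real p) ^ N"])
    fix m n assume "av (of_nat m - of_nat n) < (1 / real p) ^ N"
    then show "av ((\<Sum>k<m. \<psi> (of_nat k)) - (\<Sum>k<n. \<psi> (of_nat k))) \<le> e"
      using le[of n m] le[of m n]
      by (cases n m rule: le_cases) (auto simp: av_diff_commute)
  qed (use p_gt_1 in simp)
qed

text \<open>
  Uniform continuity on the dense subset of natural numbers is what the extension to the closure
  \<open>Zp\<close> needs; the target being complete, the extension exists.
\<close>

lemma indef_sum_exists:
  fixes \<psi> :: "'c \<Rightarrow> 'c"
  assumes "\<psi> \<in> C_Zp"
  shows "\<exists>F\<in>C_Zp. \<forall>n::nat. F (of_nat n) = (\<Sum>k<n. \<psi> (of_nat k))"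
proof -
  \<comment> \<open>Only values at natural numbers matter; elsewhere \<open>inv\<close> gives an arbitrary index.\<close>
  define S where "S x = (\<Sum>k<inv of_nat x. \<psi> (of_nat k))" for x :: 'c
  have S: "S (of_nat n) = (\<Sum>k<n. \<psi> (of_nat k))" for n
    by (simp add: S_def inv_f_f[OF inj_of_nat])
  have "uniformly_continuous_on (range of_nat) S"
    unfolding uniformly_continuous_on_def
  proof (intro allI impI)
    fix e :: real assume "0 < e"
    then have "0 < e / 2"
      by simp
    then obtain d where d: "0 < d" "\<And>m n. av (of_nat m - of_nat n) < d \<Longrightarrow>
        av ((\<Sum>k<m. \<psi> (of_nat k)) - (\<Sum>k<n. \<psi> (of_nat k))) \<le> e / 2"
      using partial_sums_uniformly_continuous[OF assms] by blast
    have "dist (S (of_nat m)) (S (of_nat n)) < e" if "dist (of_nat m :: 'c) (of_nat n) < d" for m n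
      using d(2)[of m n] that \<open>0 < e\<close> by (simp add: S dist_av)
    with d(1) show "\<exists>d>0. \<forall>x\<in>range of_nat. \<forall>x'\<in>range of_nat. dist x' x < d \<longrightarrow> dist (S x') (S x) < e"
      by blast
  qed
  then obtain G where G: "uniformly_continuous_on Zp G" "\<And>x. x \<in> range of_nat \<Longrightarrow> S x = G x"
    unfolding Zp_eq_closure_of_nat by (rule uniformly_continuous_on_extension_on_closure) blast
  have "continuous_on Zp (restrict G Zp)"
    using uniformly_continuous_imp_continuous[OF G(1)] by (simp cong: continuous_on_cong)
  then have "restrict G Zp \<in> C_Zp"
    by (simp add: C_Zp_def)
  moreover have "restrict G Zp (of_nat n) = (\<Sum>k<n. \<psi> (of_nat k))" for n
    using G(2)[of "of_nat n"] S by simp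
  ultimately show ?thesis
    by blast
qed

lemma indef_sum:
  fixes \<psi> :: "'c \<Rightarrow> 'c"
  assumes "\<psi> \<in> C_Zp"
  shows "indef_sum \<psi> \<in> C_Zp" "indef_sum \<psi> (of_nat n) = (\<Sum>k<n. \<psi> (of_nat k))"
proof -
  have "\<exists>!F. F \<in> C_Zp \<and> (\<forall>n::nat. F (of_nat n) = (\<Sum>k<n. \<psi> (of_nat k)))"
    using indef_sum_exists[OF assms] by (auto intro: C_Zp_eqI)
  then have "indef_sum \<psi> \<in> C_Zp \<and> (\<forall>n::nat. indef_sum \<psi> (of_nat n) = (\<Sum>k<n. \<psi> (of_nat k)))"
    unfolding indef_sum_def by (rule theI')
  then show "indef_sum \<psi> \<in> C_Zp" "indef_sum \<psi> (of_nat n) = (\<Sum>k<n. \<psi> (of_nat k))"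
    by auto
qed

lemma indef_sum_step:
  fixes \<psi> :: "'c \<Rightarrow> 'c"
  assumes \<psi>: "\<psi> \<in> C_Zp" and x: "x \<in> Zp"
  shows "indef_sum \<psi> (x + 1) = indef_sum \<psi> x + \<psi> x"
proof -
  have F: "continuous_on Zp (indef_sum \<psi>)" and c: "continuous_on Zp \<psi>"
    using indef_sum(1)[OF \<psi>] \<psi> by (simp_all add: C_Zp_def)
  have "continuous_on Zp (\<lambda>x::'c. x + 1)"
    unfolding continuous_on_def by (intro ballI tendsto_add_av tendsto_ident_at tendsto_const)
  moreover have "(\<lambda>x::'c. x + 1) ` Zp \<subseteq> Zp"
    using Zp_add[OF _ of_nat_in_Zp[of 1]] by auto
  ultimately have left: "continuous_on Zp (\<lambda>x. indef_sum \<psi> (x + 1))"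
    by (rule continuous_on_compose2[OF F])
  have right: "continuous_on Zp (\<lambda>x. indef_sum \<psi> x + \<psi> x)"
    using F c unfolding continuous_on_def by (blast intro: tendsto_add_av)
  have "indef_sum \<psi> (of_nat n + 1) = indef_sum \<psi> (of_nat n) + \<psi> (of_nat n)" for n
    using indef_sum(2)[OF \<psi>, of "Suc n"] indef_sum(2)[OF \<psi>, of n] by (simp add: add.commute)
  from Zp_eqI[OF left right this x] show ?thesis .
qed

section \<open>The series defining the image\<close>

text \<open>
  Among any \<open>p\<close> consecutive factors of the falling factorial one is divisible by \<open>p\<close>, whatever the
  p-adic integer \<open>s\<close> is; so the decay is uniform in \<open>s\<close>.
\<close>

lemma av_falling_block:
  assumes s: "s \<in> (Zp :: 'c set)"
  shows "av (falling s p) \<le> 1 / real p"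
proof -
  obtain r where "r < p ^ 1" "av (s - of_nat r) \<le> (1 / real p) ^ 1"
    by (rule Zp_residue[OF s])
  then have r: "r < p" "av (s - of_nat r) \<le> 1 / real p"
    by simp_all
  have le1: "av (s - of_nat i) \<le> 1" for i
    by (intro av_Zp_le_1 Zp_diff s of_nat_in_Zp)
  have av_prod: "av (prod f A) = (\<Prod>i\<in>A. av (f i))" for f and A :: "nat set"
    by (induction A rule: infinite_finite_induct) (simp_all add: av_mult)
  have "av (falling s p) = av (s - of_nat r) * (\<Prod>i\<in>{..<p} - {r}. av (s - of_nat i))"
    unfolding falling_def using r(1)
    by (simp add: prod.remove[of "{..<p}" r] av_mult av_prod)
  also have "\<dots> \<le> 1 / real p * 1"
    using r(2) le1 by (intro mult_mono prod_le_1 prod_nonneg) auto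
  finally show ?thesis
    by simp
qed

lemma av_falling_le:
  assumes s: "s \<in> (Zp :: 'c set)"
  shows "av (falling s n) \<le> (1 / real p) ^ (n div p)"
proof -
  have le1: "av (falling t m) \<le> 1" if "t \<in> Zp" for t :: 'c and m
  proof (induction m)
    case (Suc m)
    have "av (t - of_nat m) \<le> 1"
      by (intro av_Zp_le_1 Zp_diff that of_nat_in_Zp)
    with Suc show ?case
      unfolding falling_Suc av_mult by (intro mult_le_one av_nonneg)
  qed simp
  have full: "av (falling s (q * p)) \<le> (1 / real p) ^ q" for q
  proof (induction q)
    case (Suc q)
    have "falling s (Suc q * p) = falling (s - of_nat (q * p)) p * falling s (q * p)"
      using falling_add[of s "q * p" p] by (simp add: algebra_simps)
    also have "av \<dots> \<le> 1 / real p * (1 / real p) ^ q"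
      unfolding av_mult using Suc
      by (intro mult_mono av_falling_block Zp_diff s of_nat_in_Zp) auto
    finally show ?case
      by simp
  qed simp
  have "falling s n = falling s (n div p * p) * falling (s - of_nat (n div p * p)) (n mod p)"
    using falling_add[of s "n div p * p" "n mod p"] by simp
  also have "av \<dots> \<le> (1 / real p) ^ (n div p) * 1"
    unfolding av_mult by (intro mult_mono full le1 Zp_diff s of_nat_in_Zp) auto
  finally show ?thesis
    by simp
qed

lemma falling_bound_tendsto_0: "(\<lambda>n. B * (1 / real p) ^ (n div p)) \<longlonglongrightarrow> 0"
proof -
  have "filterlim (\<lambda>n. n div p) at_top sequentially"
    using prime_gt_0_nat[OF prime_p] by (intro filterlim_at_top_div_const_nat)
  then have "(\<lambda>n. (1 / real p) ^ (n div p)) \<longlonglongrightarrow> 0"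
    by (rule filterlim_compose[OF p_power_tendsto_0])
  from tendsto_mult_left[OF this, of B] show ?thesis
    by simp
qed

lemma script_I_uniform_limit:
  fixes \<psi> :: "'c \<Rightarrow> 'c"
  assumes "\<psi> \<in> C_Zp"
  shows "uniform_limit Zp (\<lambda>N s. \<Sum>n<N. \<psi> (- 1 - of_nat n) * falling s n) (script_I \<psi>) sequentially"
proof -
  obtain B where B: "0 < B" "\<And>x. x \<in> Zp \<Longrightarrow> av (\<psi> x) \<le> B"
    using C_Zp_bounded[OF assms] by blast
  have "av (\<psi> (- 1 - of_nat n) * falling s n) \<le> B * (1 / real p) ^ (n div p)"
    if "s \<in> Zp" for s n
    unfolding av_mult using B that by (intro mult_mono av_falling_le) auto
  then have "uniform_limit Zp (\<lambda>N s. \<Sum>n<N. \<psi> (- 1 - of_nat n) * falling s n)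
      (\<lambda>s. \<Sum>n. \<psi> (- 1 - of_nat n) * falling s n) sequentially"
    using falling_bound_tendsto_0 by (rule uniform_limit_suminf_av)
  then show ?thesis
    by (simp add: script_I_falling cong: uniform_limit_cong')
qed

lemma script_I_in_C_Zp:
  fixes \<psi> :: "'c \<Rightarrow> 'c"
  assumes "\<psi> \<in> C_Zp"
  shows "script_I \<psi> \<in> C_Zp"
proof -
  have term_cont: "continuous_on Zp (\<lambda>s. \<psi> (- 1 - of_nat n) * falling s n)" for n
    using continuous_on_falling[of Zp n] unfolding continuous_on_def
    by (auto intro: tendsto_mult_av)
  have "continuous_on Zp (script_I \<psi>)"
    by (rule uniform_limit_theorem[OF _ script_I_uniform_limit[OF assms]])
      (intro always_eventually allI continuous_on_sum_av term_cont, simp)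
  then show ?thesis
    by (simp add: C_Zp_def script_I_def)
qed

section \<open>The operator on series in falling factorials\<close>

text \<open>
  If \<open>script_S f = script_S g\<close>, then evaluation at \<open>x = 0\<close>, where the shifted term drops out, gives
  \<open>f 0 = g 0\<close>, and evaluation at \<open>x = n + 1\<close> carries agreement from \<open>n\<close> to \<open>n + 1\<close>. The natural
  numbers are dense.
\<close>

lemma inj_on_script_S: "inj_on script_S (C_Zp :: ('c \<Rightarrow> 'c) set)"
proof (rule inj_onI)
  fix f g :: "'c \<Rightarrow> 'c"
  assume f: "f \<in> C_Zp" and g: "g \<in> C_Zp" and "script_S f = script_S g"
  have eq: "f x - x * f (x - 1) = g x - x * g (x - 1)" if "x \<in> Zp" for x
    using fun_cong[OF \<open>script_S f = script_S g\<close>, of x] that by (simp add: script_S_def)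
  have "f (of_nat n) = g (of_nat n)" for n
  proof (induction n)
    case 0
    then show ?case
      using eq[of 0] of_nat_in_Zp[of 0] by simp
  next
    case (Suc n)
    then show ?case
      using eq[of "of_nat (Suc n)"] of_nat_in_Zp[of "Suc n"] by simp
  qed
  then show "f = g"
    by (rule C_Zp_eqI[OF f g])
qed

text \<open>
  Since \<open>x * falling (x - 1) n = falling x (n + 1)\<close>, applying \<open>script_S\<close> to a series in falling factorials
  replaces its coefficients by their differences; the hypotheses say that these differences are
  the values of \<open>\<psi>\<close>, and that the boundary term at \<open>n = 0\<close> vanishes.
\<close>

lemma script_S_script_I:
  fixes \<phi> \<psi> :: "'c \<Rightarrow> 'c"
  assumes \<phi>: "\<phi> \<in> C_Zp" and \<psi>: "\<psi> \<in> C_Zp" and zero: "\<phi> 0 = 0"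
    and step: "\<And>x. x \<in> Zp \<Longrightarrow> \<phi> (x + 1) = \<phi> x - \<psi> x"
  shows "script_S (script_I \<phi>) = script_I \<psi>"
proof -
  have "script_I \<phi> x - x * script_I \<phi> (x - 1) = script_I \<psi> x" if x: "x \<in> Zp" for x
  proof -
    have x1: "x - 1 \<in> Zp"
      using Zp_diff[OF x of_nat_in_Zp[of 1]] by simp
    let ?A = "\<lambda>N s. \<Sum>n<N. \<phi> (- 1 - of_nat n) * falling s n"
    let ?B = "\<lambda>N. \<Sum>n<N. \<psi> (- 1 - of_nat n) * falling x n"
    let ?E = "\<lambda>N. \<phi> (- of_nat N) * falling x N"
    have coeff: "\<phi> (- of_nat N) = \<phi> (- 1 - of_nat N) - \<psi> (- 1 - of_nat N)" for N
      using step[of "- 1 - of_nat N"] by simp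
    \<comment> \<open>Summation by parts; the boundary term \<open>?E 0\<close> is \<open>\<phi> 0\<close>, and \<open>?E N\<close> tends to zero.\<close>
    have parts: "?A N x - x * ?A N (x - 1) = ?B N - ?E N" for N
    proof (induction N)
      case 0
      then show ?case
        by (simp add: zero)
    next
      case (Suc N)
      have "?A (Suc N) x - x * ?A (Suc N) (x - 1) = (?A N x - x * ?A N (x - 1))
          + \<phi> (- 1 - of_nat N) * falling x N - \<phi> (- 1 - of_nat N) * (x * falling (x - 1) N)"
        by (simp add: algebra_simps)
      also have "\<dots> = ?B (Suc N) - ?E (Suc N)"
        unfolding Suc falling_shift coeff[of N] by (simp add: algebra_simps)
      finally show ?case .
    qed
    obtain C where C: "0 < C" "\<And>x. x \<in> Zp \<Longrightarrow> av (\<phi> x) \<le> C"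
      using C_Zp_bounded[OF \<phi>] by blast
    have E: "?E \<longlonglongrightarrow> 0"
      unfolding tendsto_av_iff
    proof (rule tendsto_sandwich[where f = "\<lambda>_. 0"])
      show "(\<lambda>N. C * (1 / real p) ^ (N div p)) \<longlonglongrightarrow> 0"
        by (rule falling_bound_tendsto_0)
      have "av (?E N - 0) \<le> C * (1 / real p) ^ (N div p)" for N
        unfolding diff_zero av_mult using C x by (intro mult_mono av_falling_le) auto
      then show "\<forall>\<^sub>F N in sequentially. av (?E N - 0) \<le> C * (1 / real p) ^ (N div p)"
        by simp
    qed simp_all
    have "(\<lambda>N. ?A N x - x * ?A N (x - 1)) \<longlonglongrightarrow> script_I \<phi> x - x * script_I \<phi> (x - 1)"
      by (intro tendsto_diff_av tendsto_mult_av tendsto_const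
          tendsto_uniform_limitI[OF script_I_uniform_limit[OF \<phi>]] x x1)
    moreover have "(\<lambda>N. ?B N - ?E N) \<longlonglongrightarrow> script_I \<psi> x - 0"
      by (intro tendsto_diff_av E tendsto_uniform_limitI[OF script_I_uniform_limit[OF \<psi>]] x)
    ultimately show ?thesis
      unfolding parts using LIMSEQ_unique by fastforce
  qed
  then show ?thesis
    unfolding script_S_def by (auto simp: script_I_def restrict_def fun_eq_iff)
qed

end

theorem proposition6p7:
  fixes p :: nat and av :: "'c::{field_char_0, complete_space} \<Rightarrow> real"
  assumes "padic_complex_numbers p av"
  shows "(\<forall>\<Psi> \<in> script_I ` (C_Zp :: ('c \<Rightarrow> 'c) set).
            script_S_inv \<Psi> \<in> script_I ` C_Zp) \<and>
         (\<forall>\<psi> \<in> (C_Zp :: ('c \<Rightarrow> 'c) set).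
            script_S_inv (script_I \<psi>) = script_I (\<lambda>x\<in>Zp. - indef_sum \<psi> x))"
proof -
  interpret padic_complex_numbers p av
    by (rule assms)
  have main: "(\<lambda>x\<in>Zp. - indef_sum \<psi> x) \<in> C_Zp \<and>
      script_S_inv (script_I \<psi>) = script_I (\<lambda>x\<in>Zp. - indef_sum \<psi> x)"
    if \<psi>: "\<psi> \<in> C_Zp" for \<psi> :: "'c \<Rightarrow> 'c"
  proof -
    let ?\<phi> = "\<lambda>x\<in>Zp. - indef_sum \<psi> x"
    have "continuous_on Zp (\<lambda>x. - indef_sum \<psi> x)"
      using indef_sum(1)[OF \<psi>] unfolding C_Zp_def continuous_on_def
      by (auto intro: tendsto_uminus_av)
    then have \<phi>: "?\<phi> \<in> C_Zp"
      by (simp add: C_Zp_def cong: continuous_on_cong)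
    have "script_S (script_I ?\<phi>) = script_I \<psi>"
    proof (rule script_S_script_I[OF \<phi> \<psi>])
      show "?\<phi> 0 = 0"
        using indef_sum(2)[OF \<psi>, of 0] of_nat_in_Zp[of 0] by simp
      show "?\<phi> (x + 1) = ?\<phi> x - \<psi> x" if "x \<in> Zp" for x
        using indef_sum_step[OF \<psi> that] that Zp_add[OF that of_nat_in_Zp[of 1]] by simp
    qed
    then have "script_S_inv (script_I \<psi>) = script_I ?\<phi>"
      unfolding script_S_inv_def
      by (intro inv_into_f_eq[OF inj_on_script_S script_I_in_C_Zp[OF \<phi>]])
    with \<phi> show ?thesis
      by blast
  qed
  then show ?thesis
    by auto
qed

end
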